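(* For every integer $n\ge 1$, the number $\alpha(n)$ of orbits of the action on $X_n$ (the set of $n\times n$ matrices with entries in $\{0,1\}$) of the group generated by row rotation $\sigma$, column rotation $\tau$, and matrix transposition $\zeta$ is $$ \alpha(n)=\frac{1}{2}\,a(n,n)+\frac{1}{2n}\sum_{d\,|\,n}\varphi(d)\,2^{\,n(n+d-2\lfloor d/2\rfloor)/(2d)}, $$ where $$ a(n,n)=\frac{1}{n^2}\sum_{c\,|\,n}\;\sum_{d\,|\,n}\varphi(c)\varphi(d)\,2^{\,n^2/\operatorname{lcm}(c,d)}. $$
   Context: $X_n:=\{0,1\}^{\{0,1,\ldots,n-1\}^2}$ is the set of $n\times n$ matrices of 0s and 1s, with rows and columns indexed by $0,1,\ldots,n-1$. The following permutations act on $X_n$ by permuting the positions of the entries: $\sigma$ rotates the rows (row 0 becomes row 1, row 1 becomes row 2, ..., row $n-1$ becomes row 0); $\tau$ rotates the columns in the same way (column 0 becomes column 1, ..., column $n-1$ becomes column 0); $\zeta$ transposes the matrix. Informally, $\alpha(n)$ is the number of distinct toroidal $n\times n$ binary arrays, allowing rotation of rows and/or columns as well as matrix transposition. Here $\varphi$ is Euler's phi function, $\operatorname{lcm}$ is the least common multiple, and sums over $d\,|\,n$ run over the positive divisors of $n$. *)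

theory Defs
  imports
    Complex_Main
    "HOL-Library.FuncSet"
    "HOL-Algebra.Group_Action"
    "HOL-Algebra.Generated_Groups"
    "HOL-Number_Theory.Totient"
begin

definition binary_matrices :: "nat \<Rightarrow> (nat \<times> nat \<Rightarrow> nat) set" where
  "binary_matrices n = ({0..<n} \<times> {0..<n}) \<rightarrow>\<^sub>E {0, 1}"

text \<open>
  Row \<open>i\<close> of the rotated matrix is row \<open>i - 1\<close> (modulo \<open>n\<close>) of the original one;
  the index is written \<open>i + n - 1\<close> because subtraction on \<open>nat\<close> truncates.
  The outer restrictions are needed for membership in \<^const>\<open>Bij\<close>, which consists of
  extensional functions; the inner ones for membership in \<^const>\<open>binary_matrices\<close>.
\<close>

definition row_rotation :: "nat \<Rightarrow> (nat \<times> nat \<Rightarrow> nat) \<Rightarrow> (nat \<times> nat \<Rightarrow> nat)" where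
  "row_rotation n = (\<lambda>A\<in>binary_matrices n.
     \<lambda>(i, j)\<in>{0..<n} \<times> {0..<n}. A ((i + n - 1) mod n, j))"

definition column_rotation :: "nat \<Rightarrow> (nat \<times> nat \<Rightarrow> nat) \<Rightarrow> (nat \<times> nat \<Rightarrow> nat)" where
  "column_rotation n = (\<lambda>A\<in>binary_matrices n.
     \<lambda>(i, j)\<in>{0..<n} \<times> {0..<n}. A (i, (j + n - 1) mod n))"

definition transposition :: "nat \<Rightarrow> (nat \<times> nat \<Rightarrow> nat) \<Rightarrow> (nat \<times> nat \<Rightarrow> nat)" where
  "transposition n = (\<lambda>A\<in>binary_matrices n.
     \<lambda>(i, j)\<in>{0..<n} \<times> {0..<n}. A (j, i))"

definition toroidal_group :: "nat \<Rightarrow> ((nat \<times> nat \<Rightarrow> nat) \<Rightarrow> (nat \<times> nat \<Rightarrow> nat)) monoid" where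
  "toroidal_group n = subgroup_generated (BijGroup (binary_matrices n))
     {row_rotation n, column_rotation n, transposition n}"

definition num_toroidal_arrays :: "nat \<Rightarrow> nat" where
  "num_toroidal_arrays n = card (orbits (toroidal_group n) (binary_matrices n) (\<lambda>g. g))"

text \<open>
  All exponents of 2 occurring in the formulas are in fact natural numbers; they are
  written as real quotients so that no rounding division is involved.
\<close>

definition a_diag :: "nat \<Rightarrow> real" where
  "a_diag n = 1 / real n ^ 2 *
     (\<Sum>c | c dvd n. \<Sum>d | d dvd n.
        real (totient c) * real (totient d) * 2 powr (real n ^ 2 / real (lcm c d)))"

text \<open>
  \<^const>\<open>subgroup_generated\<close> silently drops generators outside the carrier; the lemmas
  below show that nothing is dropped here, and that the group does act on the matrices.
\<close>

lemma row_rotation_entry: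
  assumes "A \<in> binary_matrices n" "i < n" "j < n"
  shows "row_rotation n A (Suc i mod n, j) = A (i, j)"
proof -
  have "(Suc i mod n + n - 1) mod n = i"
    using assms(2) by (cases "Suc i = n") auto
  with assms show ?thesis by (simp add: row_rotation_def)
qed

lemma column_rotation_entry:
  assumes "A \<in> binary_matrices n" "i < n" "j < n"
  shows "column_rotation n A (i, Suc j mod n) = A (i, j)"
proof -
  have "(Suc j mod n + n - 1) mod n = j"
    using assms(3) by (cases "Suc j = n") auto
  with assms show ?thesis by (simp add: column_rotation_def)
qed

lemma transposition_entry:
  assumes "A \<in> binary_matrices n" "i < n" "j < n"
  shows "transposition n A (j, i) = A (i, j)"
  using assms by (simp add: transposition_def)

lemma finite_binary_matrices: "finite (binary_matrices n)"
  unfolding binary_matrices_def by (intro finite_PiE) auto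

lemma Bij_binary_matricesI:
  assumes ext: "f \<in> extensional (binary_matrices n)"
    and closed: "\<And>A. A \<in> binary_matrices n \<Longrightarrow> f A \<in> binary_matrices n"
    and entry: "\<And>i j. i < n \<Longrightarrow> j < n \<Longrightarrow>
      \<exists>p. \<forall>A\<in>binary_matrices n. f A p = A (i, j)"
  shows "f \<in> Bij (binary_matrices n)"
proof -
  have "inj_on f (binary_matrices n)"
  proof (rule inj_onI)
    fix A B assume A: "A \<in> binary_matrices n" and B: "B \<in> binary_matrices n" and "f A = f B"
    have "A (i, j) = B (i, j)" if "i < n" "j < n" for i j
      using entry[OF that] A B \<open>f A = f B\<close> by metis
    then show "A = B"
      by (intro PiE_ext[OF A[unfolded binary_matrices_def] B[unfolded binary_matrices_def]]) auto
  qed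
  moreover have "f ` binary_matrices n \<subseteq> binary_matrices n"
    using closed by blast
  ultimately have "bij_betw f (binary_matrices n) (binary_matrices n)"
    using finite_binary_matrices endo_inj_surj by (metis bij_betw_def)
  with ext show ?thesis by (simp add: Bij_def)
qed

lemma row_rotation_Bij:
  assumes "n \<ge> 1" shows "row_rotation n \<in> Bij (binary_matrices n)"
proof (rule Bij_binary_matricesI)
  show "row_rotation n \<in> extensional (binary_matrices n)"
    unfolding row_rotation_def by (rule restrict_extensional)
  show "row_rotation n A \<in> binary_matrices n" if "A \<in> binary_matrices n" for A
    using that assms unfolding row_rotation_def binary_matrices_def
    by (auto simp: PiE_def Pi_def)
  show "\<exists>p. \<forall>A\<in>binary_matrices n. row_rotation n A p = A (i, j)" if "i < n" "j < n" for i j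
    using row_rotation_entry that by blast
qed

lemma column_rotation_Bij:
  assumes "n \<ge> 1" shows "column_rotation n \<in> Bij (binary_matrices n)"
proof (rule Bij_binary_matricesI)
  show "column_rotation n \<in> extensional (binary_matrices n)"
    unfolding column_rotation_def by (rule restrict_extensional)
  show "column_rotation n A \<in> binary_matrices n" if "A \<in> binary_matrices n" for A
    using that assms unfolding column_rotation_def binary_matrices_def
    by (auto simp: PiE_def Pi_def)
  show "\<exists>p. \<forall>A\<in>binary_matrices n. column_rotation n A p = A (i, j)" if "i < n" "j < n" for i j
    using column_rotation_entry that by blast
qed

lemma transposition_Bij: "transposition n \<in> Bij (binary_matrices n)"
proof (rule Bij_binary_matricesI)
  show "transposition n \<in> extensional (binary_matrices n)"
    unfolding transposition_def by (rule restrict_extensional)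
  show "transposition n A \<in> binary_matrices n" if "A \<in> binary_matrices n" for A
    using that unfolding transposition_def binary_matrices_def
    by (auto simp: PiE_def Pi_def)
  show "\<exists>p. \<forall>A\<in>binary_matrices n. transposition n A p = A (i, j)" if "i < n" "j < n" for i j
    using transposition_entry that by blast
qed

lemma carrier_toroidal_group:
  assumes "n \<ge> 1"
  shows "carrier (toroidal_group n) = generate (BijGroup (binary_matrices n))
    {row_rotation n, column_rotation n, transposition n}"
proof -
  have "{row_rotation n, column_rotation n, transposition n}
      \<subseteq> carrier (BijGroup (binary_matrices n))"
    using assms row_rotation_Bij column_rotation_Bij transposition_Bij
    by (auto simp: BijGroup_def)
  then show ?thesis
    by (simp add: toroidal_group_def carrier_subgroup_generated Int_absorb1)
qed

lemma group_action_toroidal_group: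
  "group_action (toroidal_group n) (binary_matrices n) (\<lambda>g. g)"
proof -
  let ?B = "BijGroup (binary_matrices n)"
  interpret B: group ?B by (rule group_BijGroup)
  have "(\<lambda>g. g) \<in> hom (toroidal_group n) ?B"
    using B.carrier_subgroup_generated_subset
    by (auto simp: hom_def toroidal_group_def)
  then show ?thesis
    unfolding group_action_def group_hom_def group_hom_axioms_def
    by (simp add: toroidal_group_def group_BijGroup)
qed

end

theory Submission
  imports Defs "HOL-Algebra.Elementary_Groups"
begin

text \<open>
  Burnside's lemma is used twice. The semidirect product of \<open>(\<int>/n)\<^sup>2\<close> with \<open>\<int>/2\<close>
  (swapping coordinates) acts on the positions, hence on the matrices; working with it instead
  of the generated permutation group avoids treating \<open>n = 1\<close>, where that action is not
  faithful, separately. A matrix is fixed by \<open>g\<close> iff it is constant on the cycles of \<open>g\<close>, and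
  these are counted by Burnside's lemma for the cyclic group generated by \<open>g\<close>. If \<open>c\<close> and \<open>d\<close> are
  the orders of \<open>a\<close> and \<open>b\<close> modulo \<open>n\<close>, translation by \<open>(a, b)\<close> has order \<open>lcm c d\<close> and no
  nontrivial power of it has a fixed point. A flip \<open>(i, j) \<mapsto> (j + a, i + b)\<close> squares to the
  translation by \<open>(a + b, a + b)\<close>, of order \<open>d\<close> say; among its first \<open>2 d\<close> powers only the identity
  and, for odd \<open>d\<close>, the \<open>d\<close>-th power have fixed points, the latter exactly \<open>n\<close>. Finally,
  \<open>\<phi>(d)\<close> residues modulo \<open>n\<close> have order \<open>d\<close>.
\<close>

section \<open>Group actions from action laws and from powers of one element\<close>

text \<open>The action of the inverse element is a two-sided inverse map, so closure and the two
  action laws already yield bijectivity. Restricting to \<open>E\<close> makes the maps extensional,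
  as \<open>Bij\<close> demands.\<close>

lemma group_action_restrictI:
  assumes G: "group G"
    and closed: "\<And>g x. g \<in> carrier G \<Longrightarrow> x \<in> E \<Longrightarrow> f g x \<in> E"
    and mult: "\<And>g h x. g \<in> carrier G \<Longrightarrow> h \<in> carrier G \<Longrightarrow> x \<in> E \<Longrightarrow>
      f (g \<otimes>\<^bsub>G\<^esub> h) x = f g (f h x)"
    and one: "\<And>x. x \<in> E \<Longrightarrow> f \<one>\<^bsub>G\<^esub> x = x"
  shows "group_action G E (\<lambda>g. restrict (f g) E)"
proof -
  interpret group G by fact
  have Bij: "restrict (f g) E \<in> Bij E" if g: "g \<in> carrier G" for g
  proof -
    have "bij_betw (f g) E E"
    proof (rule bij_betwI[where g = "f (inv\<^bsub>G\<^esub> g)"])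
      show "f (inv\<^bsub>G\<^esub> g) (f g x) = x" if "x \<in> E" for x
        using mult[of "inv\<^bsub>G\<^esub> g" g x] g that one by simp
      show "f g (f (inv\<^bsub>G\<^esub> g) x) = x" if "x \<in> E" for x
        using mult[of g "inv\<^bsub>G\<^esub> g" x] g that one by simp
    qed (use closed g in auto)
    then show ?thesis
      by (simp add: Bij_def)
  qed
  have "(\<lambda>g. restrict (f g) E) \<in> hom G (BijGroup E)"
    using Bij by (auto simp: hom_def BijGroup_def compose_def restrict_def fun_eq_iff mult closed)
  then show ?thesis
    by (simp add: group_action_def group_hom_def group_hom_axioms_def group_BijGroup G)
qed

text \<open>Exponents of \<open>g\<close> may be reduced modulo \<open>N\<close>. Composing with
  this homomorphism turns an action of the whole group into an action of the cyclic group of order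
  \<open>N\<close>, whose orbits are the cycles of \<open>g\<close>.\<close>

lemma (in group) pow_mod_hom:
  assumes g: "g \<in> carrier G" and N: "N > 0" "g [^] (N::nat) = \<one>"
  shows "group_hom (integer_mod_group N) G (\<lambda>k. g [^] nat k)"
proof -
  have eq: "g [^] (k mod N) = g [^] k" for k :: nat
  proof -
    have "g [^] k = g [^] (N * (k div N) + k mod N)"
      by simp
    also have "\<dots> = (g [^] N) [^] (k div N) \<otimes> g [^] (k mod N)"
      using g by (simp only: nat_pow_mult nat_pow_pow nat_pow_closed)
    finally show ?thesis
      using g N by simp
  qed
  have "g [^] nat ((x + y) mod int N) = g [^] nat x \<otimes> g [^] nat y" if "0 \<le> x" "0 \<le> y" for x y
  proof -
    have "nat ((x + y) mod int N) = (nat x + nat y) mod N"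
      using that by (simp add: nat_mod_distrib nat_add_distrib)
    then show ?thesis
      using g by (simp add: eq nat_pow_mult)
  qed
  then show ?thesis
    using g N by (auto simp: group_hom_def group_hom_axioms_def is_group hom_def
        carrier_integer_mod_group)
qed

section \<open>Colourings of a set with a group action\<close>

text \<open>Precomposition reverses the order of products; the inverse makes this a left
  action.\<close>

definition colouring_action ::
  "('g, 'm) monoid_scheme \<Rightarrow> 'a set \<Rightarrow> 'c set \<Rightarrow> ('g \<Rightarrow> 'a \<Rightarrow> 'a) \<Rightarrow> 'g \<Rightarrow> ('a \<Rightarrow> 'c) \<Rightarrow> 'a \<Rightarrow> 'c"
  where "colouring_action G E C \<phi> g =
    (\<lambda>A \<in> E \<rightarrow>\<^sub>E C. \<lambda>x \<in> E. A (\<phi> (inv\<^bsub>G\<^esub> g) x))"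

context group_action
begin

lemma group_action_colouring: "group_action G (E \<rightarrow>\<^sub>E C) (colouring_action G E C \<phi>)"
proof -
  interpret group G
    using group_hom by (rule group_hom.axioms)
  show ?thesis
    unfolding colouring_action_def
  proof (rule group_action_restrictI)
    show "group G" by (rule is_group)
    show "(\<lambda>x\<in>E. A (\<phi> (inv g) x)) \<in> E \<rightarrow>\<^sub>E C" if "g \<in> carrier G" "A \<in> E \<rightarrow>\<^sub>E C" for g A
      using that element_image[of "inv g"] by auto
    show "(\<lambda>x\<in>E. A (\<phi> (inv (g \<otimes> h)) x)) =
        (\<lambda>x\<in>E. (\<lambda>x\<in>E. A (\<phi> (inv h) x)) (\<phi> (inv g) x))"
      if "g \<in> carrier G" "h \<in> carrier G" "A \<in> E \<rightarrow>\<^sub>E C" for g h A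
      using that element_image[of "inv g"]
      by (auto simp: inv_mult_group composition_rule fun_eq_iff)
    show "(\<lambda>x\<in>E. A (\<phi> (inv \<one>) x)) = A" if "A \<in> E \<rightarrow>\<^sub>E C" for A
      using that id_eq_one[symmetric] by (auto simp: fun_eq_iff)
  qed
qed

text \<open>Since \<open>g\<close> permutes \<open>E\<close>, invariance under precomposition with
  the inverse of \<open>g\<close> is the same as invariance under \<open>g\<close> itself, so the
  inverse in the definition disappears from the counting.\<close>

lemma invariants_colouring:
  assumes g: "g \<in> carrier G"
  shows "invariants (E \<rightarrow>\<^sub>E C) (colouring_action G E C \<phi>) g =
    {A \<in> E \<rightarrow>\<^sub>E C. \<forall>x\<in>E. A (\<phi> g x) = A x}"
proof -
  interpret group G
    using group_hom by (rule group_hom.axioms)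
  have inv: "\<phi> g (\<phi> (inv g) x) = x" "\<phi> (inv g) (\<phi> g x) = x" if "x \<in> E" for x
    using that g composition_rule[of x g "inv g"] composition_rule[of x "inv g" g]
      id_eq_one[symmetric] by auto
  have mem: "\<phi> g x \<in> E" "\<phi> (inv g) x \<in> E" if "x \<in> E" for x
    using that g element_image inv_closed by blast+
  have "colouring_action G E C \<phi> g A = A \<longleftrightarrow> (\<forall>x\<in>E. A (\<phi> g x) = A x)" if A: "A \<in> E \<rightarrow>\<^sub>E C" for A
  proof -
    have "colouring_action G E C \<phi> g A = A \<longleftrightarrow> (\<forall>x\<in>E. A (\<phi> (inv g) x) = A x)"
    proof
      assume "colouring_action G E C \<phi> g A = A"
      then have "(\<lambda>x\<in>E. A (\<phi> (inv g) x)) = A"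
        using A by (simp add: colouring_action_def)
      then show "\<forall>x\<in>E. A (\<phi> (inv g) x) = A x"
        by (metis restrict_apply')
    next
      assume "\<forall>x\<in>E. A (\<phi> (inv g) x) = A x"
      then have "(\<lambda>x\<in>E. A (\<phi> (inv g) x)) = (\<lambda>x\<in>E. A x)"
        by (intro restrict_ext) simp
      also have "\<dots> = A"
        using A by (rule PiE_restrict)
      finally show "colouring_action G E C \<phi> g A = A"
        using A by (simp add: colouring_action_def)
    qed
    also have "\<dots> \<longleftrightarrow> (\<forall>x\<in>E. A (\<phi> g x) = A x)"
      using inv mem by metis
    finally show ?thesis .
  qed
  then show ?thesis
    by (auto simp: invariants_def)
qed

text \<open>
  Burnside's lemma for the cyclic group generated by \<open>g\<close> counts the cycles of \<open>g\<close>;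
  the exponent \<open>N\<close> need not be the exact order.
\<close>

lemma card_invariants_colouring:
  assumes g: "g \<in> carrier G" and N: "N > 0" "g [^] (N::nat) = \<one>"
    and fin: "finite E" and C: "card C > 0"
  shows "real (card (invariants (E \<rightarrow>\<^sub>E C) (colouring_action G E C \<phi>) g)) =
    real (card C) powr (real (\<Sum>k<N. card (invariants E \<phi> (g [^] k))) / real N)"
proof -
  interpret group G
    using group_hom by (rule group_hom.axioms)
  define Z where "Z = integer_mod_group N"
  define \<rho> where "\<rho> = (\<lambda>k::int. \<phi> (g [^] nat k))"
  have carrier_Z: "carrier Z = int ` {..<N}"
    using N by (auto simp: Z_def carrier_integer_mod_group image_int_atLeastLessThan lessThan_atLeast0)
  interpret Z: group_action Z E \<rho>
  proof (rule group_action.intro)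
    have "group_hom Z G (\<lambda>k. g [^] nat k)"
      unfolding Z_def using g N by (rule pow_mod_hom)
    then show "group_hom Z (BijGroup E) \<rho>"
      using group_hom Group.hom_compose[of "\<lambda>k. g [^] nat k" Z G \<phi> "BijGroup E"]
      by (auto simp: group_hom_def group_hom_axioms_def \<rho>_def o_def)
  qed
  define Orb where "Orb = orbits Z E \<rho>"
  have "card Orb * order Z = (\<Sum>k\<in>carrier Z. card (invariants E \<rho> k))"
    unfolding Orb_def by (rule Z.burnside) (auto simp: carrier_Z fin)
  also have "\<dots> = (\<Sum>k<N. card (invariants E \<phi> (g [^] k)))"
    unfolding carrier_Z by (simp add: sum.reindex invariants_def \<rho>_def)
  finally have count: "card Orb * N = (\<Sum>k<N. card (invariants E \<phi> (g [^] k)))"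
    by (simp add: order_def carrier_Z card_image)
  have fin_Orb: "finite Orb"
    using fin by (auto simp: Orb_def orbits_def)
  have orbit_mem: "orbit Z \<rho> x \<in> Orb" if "x \<in> E" for x
    using that by (auto simp: Orb_def orbits_def)
  have orbit_eq: "orbit Z \<rho> (\<phi> g x) = orbit Z \<rho> x" if x: "x \<in> E" for x
  proof -
    have gx: "\<phi> g x \<in> E"
      using element_image g x by blast
    \<comment> \<open>The exponent 1 lies outside the carrier when \<open>N = 1\<close>; then
      \<open>g\<close> is the identity and the exponent 0 serves.\<close>
    have "\<phi> g x = \<rho> (int (1 mod N)) x"
      using N g by (cases "N = 1") (auto simp: \<rho>_def)
    then have "\<phi> g x \<in> orbit Z \<rho> x"
      using N by (auto simp: orbit_def carrier_Z)
    then have "\<phi> g x \<in> orbit Z \<rho> x \<inter> orbit Z \<rho> (\<phi> g x)"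
      using Z.orbit_refl gx by blast
    then show ?thesis
      using Z.disjoint_union orbit_mem x gx unfolding Orb_def by blast
  qed
  \<comment> \<open>Colourings of the set of orbits, pulled back to points, are exactly the
    colourings invariant under \<open>g\<close>.\<close>
  have "bij_betw (\<lambda>F. \<lambda>x\<in>E. F (orbit Z \<rho> x)) (Orb \<rightarrow>\<^sub>E C)
    {A \<in> E \<rightarrow>\<^sub>E C. \<forall>x\<in>E. A (\<phi> g x) = A x}"
    (is "bij_betw ?h _ ?I")
    unfolding bij_betw_def
  proof
    show "inj_on ?h (Orb \<rightarrow>\<^sub>E C)"
    proof (rule inj_onI)
      fix F F' assume F: "F \<in> Orb \<rightarrow>\<^sub>E C" "F' \<in> Orb \<rightarrow>\<^sub>E C" and eq: "?h F = ?h F'"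
      have "F (orbit Z \<rho> x) = F' (orbit Z \<rho> x)" if "x \<in> E" for x
        using fun_cong[OF eq, of x] that by simp
      then show "F = F'"
        using F by (intro PiE_ext[of F Orb "\<lambda>_. C" F']) (auto simp: Orb_def orbits_def)
    qed
    show "?h ` (Orb \<rightarrow>\<^sub>E C) = ?I"
    proof
      show "?h ` (Orb \<rightarrow>\<^sub>E C) \<subseteq> ?I"
        using orbit_eq orbit_mem element_image[OF g] by auto
      show "?I \<subseteq> ?h ` (Orb \<rightarrow>\<^sub>E C)"
      proof
        fix A assume A: "A \<in> ?I"
        have pow: "A (\<phi> (g [^] k) x) = A x" if x: "x \<in> E" for k :: nat and x
        proof (induction k)
          case 0
          then show ?case
            using x id_eq_one[symmetric] by simp
        next
          case (Suc k)
          have "\<phi> (g [^] Suc k) x = \<phi> g (\<phi> (g [^] k) x)"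
            using g x by (metis composition_rule nat_pow_Suc2 nat_pow_closed)
          moreover have "\<phi> (g [^] k) x \<in> E"
            using g x element_image nat_pow_closed by blast
          ultimately show ?case
            using Suc A by simp
        qed
        have const: "A ` orbit Z \<rho> x = {A x}" if x: "x \<in> E" for x
          using Z.orbit_refl[OF x] pow[OF x] by (force simp: orbit_def \<rho>_def)
        have AEC: "A \<in> E \<rightarrow>\<^sub>E C"
          using A by simp
        \<comment> \<open>The preimage of \<open>A\<close> gives each orbit the single colour that
          \<open>A\<close> takes on it.\<close>
        have "?h (\<lambda>S\<in>Orb. the_elem (A ` S)) = A"
        proof
          show "?h (\<lambda>S\<in>Orb. the_elem (A ` S)) x = A x" for x
            using orbit_mem[of x] const[of x] PiE_arb[OF AEC, of x] by (cases "x \<in> E") simp_all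
        qed
        moreover have "(\<lambda>S\<in>Orb. the_elem (A ` S)) \<in> Orb \<rightarrow>\<^sub>E C"
        proof (rule PiE_I)
          fix S assume "S \<in> Orb"
          then obtain x where "x \<in> E" "S = orbit Z \<rho> x"
            by (auto simp: Orb_def orbits_def)
          then show "(\<lambda>S\<in>Orb. the_elem (A ` S)) S \<in> C"
            using \<open>S \<in> Orb\<close> const[of x] PiE_mem[OF AEC, of x] by simp
        qed simp
        ultimately show "A \<in> ?h ` (Orb \<rightarrow>\<^sub>E C)"
          by (rule image_eqI[OF sym])
      qed
    qed
  qed
  then have "card ?I = card (Orb \<rightarrow>\<^sub>E C)"
    by (simp add: bij_betw_same_card)
  also have "\<dots> = card C ^ card Orb"
    using fin_Orb by (simp add: card_PiE)
  finally have "card ?I = card C ^ card Orb" .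
  \<comment> \<open>The quotient is exactly the number of orbits, so the real power is a natural
    one; this conversion uses that \<open>card C\<close> is positive.\<close>
  moreover have "real (\<Sum>k<N. card (invariants E \<phi> (g [^] k))) / real N = real (card Orb)"
    unfolding count[symmetric] using N by simp
  ultimately show ?thesis
    using C by (simp only: invariants_colouring[OF g] powr_realpow of_nat_power of_nat_0_less_iff)
qed

end

section \<open>The semidirect product and its action on positions\<close>

text \<open>A triple \<open>(a, b, e)\<close> stands for the map that transposes if \<open>e\<close> and then translates by \<open>(a, b)\<close>.\<close>

definition torus_group :: "nat \<Rightarrow> (nat \<times> nat \<times> bool) monoid" where
  "torus_group n =
    \<lparr>carrier = {0..<n} \<times> {0..<n} \<times> UNIV,
     monoid.mult = (\<lambda>(a, b, e) (c, d, f).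
       ((a + (if e then d else c)) mod n, (b + (if e then c else d)) mod n, e \<noteq> f)),
     one = (0, 0, False)\<rparr>"

definition torus_map :: "nat \<Rightarrow> nat \<times> nat \<times> bool \<Rightarrow> nat \<times> nat \<Rightarrow> nat \<times> nat" where
  "torus_map n = (\<lambda>(a, b, e) (i, j).
     if e then ((j + a) mod n, (i + b) mod n) else ((i + a) mod n, (j + b) mod n))"

definition torus_action :: "nat \<Rightarrow> nat \<times> nat \<times> bool \<Rightarrow> nat \<times> nat \<Rightarrow> nat \<times> nat" where
  "torus_action n g = restrict (torus_map n g) ({0..<n} \<times> {0..<n})"

lemma carrier_torus_group: "carrier (torus_group n) = {0..<n} \<times> {0..<n} \<times> UNIV"
  by (simp add: torus_group_def)

lemma one_torus_group: "\<one>\<^bsub>torus_group n\<^esub> = (0, 0, False)"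
  by (simp add: torus_group_def)

lemma mult_torus_group:
  "(a, b, e) \<otimes>\<^bsub>torus_group n\<^esub> (c, d, f) =
    ((a + (if e then d else c)) mod n, (b + (if e then c else d)) mod n, e \<noteq> f)"
  by (simp add: torus_group_def)

lemma minus_mod_add_self: "a < n \<Longrightarrow> ((n - a) mod n + a) mod n = (0::nat)"
  by (cases "a = 0") auto

lemma group_torus_group:
  assumes "n > 0"
  shows "group (torus_group n)"
proof (rule groupI)
  fix x assume "x \<in> carrier (torus_group n)"
  then obtain a b e where x: "x = (a, b, e)" "a < n" "b < n"
    by (auto simp: carrier_torus_group)
  \<comment> \<open>Transposition exchanges the two shifts, so the inverse of a flip has them
    swapped. The reduction \<open>mod n\<close> matters for a zero shift, where \<open>n - 0\<close>
    is out of range.\<close>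
  define y where "y = (if e then ((n - b) mod n, (n - a) mod n, e) else ((n - a) mod n, (n - b) mod n, e))"
  have "y \<otimes>\<^bsub>torus_group n\<^esub> x = \<one>\<^bsub>torus_group n\<^esub>" "y \<in> carrier (torus_group n)"
    using x assms
    by (auto simp: y_def mult_torus_group one_torus_group carrier_torus_group minus_mod_add_self)
  then show "\<exists>y\<in>carrier (torus_group n). y \<otimes>\<^bsub>torus_group n\<^esub> x = \<one>\<^bsub>torus_group n\<^esub>"
    by blast
next
  show "x \<otimes>\<^bsub>torus_group n\<^esub> y \<in> carrier (torus_group n)"
    if "x \<in> carrier (torus_group n)" "y \<in> carrier (torus_group n)" for x y
    using assms by (cases x; cases y) (simp add: carrier_torus_group mult_torus_group)
  show "\<one>\<^bsub>torus_group n\<^esub> \<in> carrier (torus_group n)"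
    using assms by (simp add: carrier_torus_group one_torus_group)
  show "\<one>\<^bsub>torus_group n\<^esub> \<otimes>\<^bsub>torus_group n\<^esub> x = x" if "x \<in> carrier (torus_group n)" for x
    using that by (cases x) (simp add: carrier_torus_group one_torus_group mult_torus_group)
  show "x \<otimes>\<^bsub>torus_group n\<^esub> y \<otimes>\<^bsub>torus_group n\<^esub> z = x \<otimes>\<^bsub>torus_group n\<^esub> (y \<otimes>\<^bsub>torus_group n\<^esub> z)" for x y z
    by (cases x; cases y; cases z)
       (simp add: mult_torus_group mod_add_left_eq mod_add_right_eq add.assoc)
qed

lemma inv_torus_group:
  assumes "a < n" "b < n"
  shows "inv\<^bsub>torus_group n\<^esub> (a, b, e) =
    (if e then ((n - b) mod n, (n - a) mod n, e) else ((n - a) mod n, (n - b) mod n, e))"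
proof (rule group.inv_equality)
  show "group (torus_group n)"
    using assms by (intro group_torus_group) auto
qed (use assms in \<open>auto simp: mult_torus_group one_torus_group carrier_torus_group
       minus_mod_add_self\<close>)

lemma group_action_torus:
  assumes "n > 0"
  shows "group_action (torus_group n) ({0..<n} \<times> {0..<n}) (torus_action n)"
proof -
  have "group_action (torus_group n) ({0..<n} \<times> {0..<n})
    (\<lambda>g. restrict (torus_map n g) ({0..<n} \<times> {0..<n}))"
    using assms
    by (intro group_action_restrictI group_torus_group)
       (auto simp: carrier_torus_group mult_torus_group one_torus_group torus_map_def
         mod_add_left_eq mod_add_right_eq add_ac)
  then show ?thesis
    by (simp add: torus_action_def[abs_def])
qed

lemma pow_translation:
  "(a, b, False) [^]\<^bsub>torus_group n\<^esub> (k::nat) = (k * a mod n, k * b mod n, False)"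
  by (induction k)
     (auto simp: nat_pow_def one_torus_group mult_torus_group mod_add_right_eq mod_add_left_eq add_ac)

text \<open>In the square of a flip the second factor contributes its shifts swapped, so both
  coordinates move by \<open>a + b\<close>.\<close>

lemma pow_flip_even:
  "(a, b, True) [^]\<^bsub>torus_group n\<^esub> (2 * k::nat) =
    (k * (a + b) mod n, k * (a + b) mod n, False)"
  by (induction k)
     (auto simp: nat_pow_def one_torus_group mult_torus_group mod_add_right_eq mod_add_left_eq add_ac)

lemma pow_flip_odd:
  "(a, b, True) [^]\<^bsub>torus_group n\<^esub> (2 * k + 1::nat) =
    ((k * (a + b) + a) mod n, (k * (a + b) + b) mod n, True)"
proof -
  have "(a, b, True) [^]\<^bsub>torus_group n\<^esub> (2 * k + 1) =
      (a, b, True) [^]\<^bsub>torus_group n\<^esub> (2 * k) \<otimes>\<^bsub>torus_group n\<^esub> (a, b, True)"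
    by (simp add: nat_pow_def)
  also have "\<dots> = ((k * (a + b) + a) mod n, (k * (a + b) + b) mod n, True)"
    unfolding pow_flip_even mult_torus_group by (simp add: mod_add_left_eq)
  finally show ?thesis .
qed

text \<open>Powers of the two unit translations give all translations, and a right factor
  \<open>(0, 0, True)\<close> gives all flips. Writing \<open>1 mod n\<close> keeps the generators
  in the carrier for \<open>n = 1\<close>.\<close>

lemma generate_torus_group:
  assumes n: "n > 0"
  shows "generate (torus_group n) {(1 mod n, 0, False), (0, 1 mod n, False), (0, 0, True)} =
    carrier (torus_group n)"
    (is "generate ?G ?S = _")
proof
  interpret group ?G using n by (rule group_torus_group)
  have S: "?S \<subseteq> carrier ?G"
    using n by (auto simp: carrier_torus_group)
  show "generate ?G ?S \<subseteq> carrier ?G"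
    using generate_in_carrier[OF S] by blast
  have pow: "g [^]\<^bsub>?G\<^esub> (k::nat) \<in> generate ?G ?S" if "g \<in> ?S" for g k
  proof (induction k)
    case 0
    then show ?case by (simp add: generate.one)
  next
    case (Suc k)
    from generate.eng[OF Suc generate.incl[OF that]] show ?case
      by simp
  qed
  show "carrier ?G \<subseteq> generate ?G ?S"
  proof
    fix g assume "g \<in> carrier ?G"
    then obtain a b e where g: "g = (a, b, e)" "a < n" "b < n"
      by (auto simp: carrier_torus_group)
    have ab: "(1 mod n, 0, False) [^]\<^bsub>?G\<^esub> a \<otimes>\<^bsub>?G\<^esub> (0, 1 mod n, False) [^]\<^bsub>?G\<^esub> b = (a, b, False)"
      using g by (simp add: pow_translation mult_torus_group mod_mult_right_eq del: One_nat_def)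
    have "(a, b, False) \<in> generate ?G ?S"
      unfolding ab[symmetric] by (intro generate.eng pow) auto
    moreover have "(a, b, True) = (a, b, False) \<otimes>\<^bsub>?G\<^esub> (0, 0, True)"
      using g by (simp add: mult_torus_group)
    moreover have "(0, 0, True) \<in> generate ?G ?S"
      by (auto intro: generate.incl)
    ultimately show "g \<in> generate ?G ?S"
      unfolding g(1) by (cases e) (auto intro: generate.eng)
  qed
qed

section \<open>Positions fixed by translations and flips\<close>

lemma card_invariants_translation:
  assumes "a < n" "b < n"
  shows "card (invariants ({0..<n} \<times> {0..<n}) (torus_action n) (a, b, False)) =
    (if a = 0 \<and> b = 0 then n ^ 2 else 0)"
proof -
  have fix_iff: "(i + a) mod n = i \<longleftrightarrow> a = 0" if "i < n" "a < n" for i a :: nat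
    using that by (cases "i + a < n") (auto simp: mod_if)
  have "invariants ({0..<n} \<times> {0..<n}) (torus_action n) (a, b, False) =
    (if a = 0 \<and> b = 0 then {0..<n} \<times> {0..<n} else {})"
    using assms by (auto simp: invariants_def torus_action_def torus_map_def fix_iff)
  then show ?thesis
    by (simp add: power2_eq_square)
qed

text \<open>At a fixed position \<open>j\<close> determines \<open>i\<close>, and substituting back
  adds \<open>a + b\<close> to \<open>j\<close>. Hence either every \<open>j\<close> gives one fixed
  position or none does.\<close>

lemma card_invariants_flip:
  assumes "a < n" "b < n"
  shows "card (invariants ({0..<n} \<times> {0..<n}) (torus_action n) (a, b, True)) =
    (if n dvd a + b then n else 0)"
proof -
  let ?I = "invariants ({0..<n} \<times> {0..<n}) (torus_action n) (a, b, True)"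
  have I: "?I = {(i, j). i < n \<and> j < n \<and> (j + a) mod n = i \<and> (i + b) mod n = j}"
    by (auto simp: invariants_def torus_action_def torus_map_def)
  have roundtrip: "((j + a) mod n + b) mod n = j \<longleftrightarrow> n dvd a + b" if "j < n" for j
  proof -
    have "((j + a) mod n + b) mod n = (j + (a + b)) mod n"
      by (simp add: mod_add_left_eq add.assoc)
    moreover have "(j + (a + b)) mod n = j \<longleftrightarrow> (j + (a + b)) mod n = (j + 0) mod n"
      using that by simp
    moreover have "\<dots> \<longleftrightarrow> n dvd a + b"
      by (metis cong_add_lcancel_nat cong_def cong_0_iff)
    ultimately show ?thesis
      by simp
  qed
  show ?thesis
  proof (cases "n dvd a + b")
    case True
    have "?I = (\<lambda>j. ((j + a) mod n, j)) ` {0..<n}"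
      using roundtrip True by (auto simp: I)
    then show ?thesis
      using True by (simp add: card_image inj_on_def)
  next
    case False
    then have "?I = {}"
      using roundtrip by (auto simp: I)
    then show ?thesis
      using False by simp
  qed
qed

section \<open>Additive orders modulo \<open>n\<close> and sums over residues\<close>

text \<open>This identifies \<open>n div gcd a n\<close> as the additive order of \<open>a\<close>
  modulo \<open>n\<close>.\<close>

lemma dvd_mult_iff_div_gcd:
  fixes n a k :: nat
  assumes "n > 0"
  shows "n dvd k * a \<longleftrightarrow> n div gcd a n dvd k"
proof -
  define g where "g = gcd a n"
  obtain a' n' where an: "a = a' * g" "n = n' * g" "coprime a' n'"
    using gcd_coprime_exists[of a n] assms unfolding g_def by auto
  then have "g > 0"
    using assms by (auto intro: Nat.gr0I)
  then have "n div g = n'"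
    using an by simp
  moreover have "n dvd k * a \<longleftrightarrow> n' dvd k * a'"
    using an \<open>g > 0\<close> by (simp add: mult.assoc[symmetric])
  moreover have "n' dvd k * a' \<longleftrightarrow> n' dvd k"
    using an(3) by (simp add: coprime_dvd_mult_left_iff coprime_commute)
  ultimately show ?thesis
    by (simp add: g_def)
qed

lemma sum_lessThan_double:
  fixes f :: "nat \<Rightarrow> 'a :: comm_monoid_add"
  shows "(\<Sum>k<2 * m. f k) = (\<Sum>k<m. f (2 * k) + f (2 * k + 1))"
  by (induction m) (simp_all add: add_ac)

text \<open>Residues are grouped by their additive order; \<open>totient d\<close> of them have
  order \<open>d\<close>.\<close>

lemma sum_div_gcd:
  fixes f :: "nat \<Rightarrow> real"
  assumes "n > 0"
  shows "(\<Sum>a<n. f (n div gcd a n)) = (\<Sum>d | d dvd n. real (totient d) * f d)"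
proof -
  \<comment> \<open>The residue 0 is represented by \<open>n\<close>, which has the same gcd with
    \<open>n\<close>, because \<open>card_gcd_eq_totient\<close> counts in
    \<open>{0<..n}\<close>.\<close>
  have "(\<Sum>a<n. f (n div gcd a n)) = (\<Sum>a\<in>{0<..n}. f (n div gcd a n))"
    using assms
    by (intro sum.reindex_bij_witness[of _ "\<lambda>a. if a = n then 0 else a" "\<lambda>a. if a = 0 then n else a"])
       (auto split: if_splits)
  also have "\<dots> = (\<Sum>d | d dvd n. \<Sum>a | a \<in> {0<..n} \<and> gcd a n = d. f (n div gcd a n))"
    using assms by (intro sum.group[symmetric]) auto
  also have "\<dots> = (\<Sum>d | d dvd n. real (totient (n div d)) * f (n div d))"
    using assms by (intro sum.cong) (auto simp flip: card_gcd_eq_totient)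
  also have "\<dots> = (\<Sum>d | d dvd n. real (totient d) * f d)"
    using assms by (intro sum.reindex_bij_witness[of _ "(div) n" "(div) n"]) (auto elim: dvdE)
  finally show ?thesis .
qed

lemma sum_translate_mod:
  fixes f :: "nat \<Rightarrow> real"
  assumes "n > 0"
  shows "(\<Sum>b<n. f ((a + b) mod n)) = (\<Sum>b<n. f b)"
proof -
  have inj: "inj_on (\<lambda>b. (a + b) mod n) {..<n}"
    by (rule inj_onI) (metis cong_add_lcancel_nat cong_def lessThan_iff mod_less)
  moreover have "(\<lambda>b. (a + b) mod n) ` {..<n} = {..<n}"
    using assms by (intro endo_inj_surj inj) auto
  ultimately have "bij_betw (\<lambda>b. (a + b) mod n) {..<n} {..<n}"
    by (simp add: bij_betw_def)
  then show ?thesis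
    by (rule sum.reindex_bij_betw)
qed

section \<open>Matrices fixed by translations and flips\<close>

abbreviation torus_matrix_action ::
    "nat \<Rightarrow> nat \<times> nat \<times> bool \<Rightarrow> (nat \<times> nat \<Rightarrow> nat) \<Rightarrow> nat \<times> nat \<Rightarrow> nat" where
  "torus_matrix_action n \<equiv>
    colouring_action (torus_group n) ({0..<n} \<times> {0..<n}) {0, 1} (torus_action n)"

text \<open>The lcm is the order of the translation. Among the powers below it only the identity
  fixes positions, namely all \<open>n ^ 2\<close>, so every cycle has the lcm as its
  length.\<close>

lemma card_invariants_matrix_translation:
  assumes a: "a < n" and b: "b < n"
  shows "real (card (invariants (binary_matrices n) (torus_matrix_action n) (a, b, False))) =
    2 powr (real n ^ 2 / real (lcm (n div gcd a n) (n div gcd b n)))"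
proof -
  have n: "n > 0"
    using a by simp
  interpret group_action "torus_group n" "{0..<n} \<times> {0..<n}" "torus_action n"
    using n by (rule group_action_torus)
  define N where "N = lcm (n div gcd a n) (n div gcd b n)"
  have N: "N > 0"
    using n by (auto simp: N_def lcm_pos_nat div_greater_zero_iff gcd_le2_nat intro!: lcm_pos_nat)
  have N_dvd: "N dvd k \<longleftrightarrow> n dvd k * a \<and> n dvd k * b" for k
    unfolding N_def using n by (simp add: dvd_mult_iff_div_gcd)
  have "card (invariants ({0..<n} \<times> {0..<n}) (torus_action n) ((a, b, False) [^]\<^bsub>torus_group n\<^esub> k)) =
      (if k = 0 then n ^ 2 else 0)" if "k < N" for k
    using that n N_dvd[of k] nat_dvd_not_less[of k N]
    by (auto simp: pow_translation card_invariants_translation mod_eq_0_iff_dvd)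
  then have "(\<Sum>k<N. card (invariants ({0..<n} \<times> {0..<n}) (torus_action n)
      ((a, b, False) [^]\<^bsub>torus_group n\<^esub> k))) = n ^ 2"
    using N by (simp add: sum.delta)
  moreover have "(a, b, False) [^]\<^bsub>torus_group n\<^esub> N = \<one>\<^bsub>torus_group n\<^esub>"
    using N_dvd[of N] by (simp add: pow_translation one_torus_group)
  ultimately show ?thesis
    using card_invariants_colouring[of "(a, b, False)" N "{0, 1::nat}"] a b N
    by (simp add: carrier_torus_group binary_matrices_def N_def)
qed

text \<open>The first \<open>2 * d\<close> powers fix \<open>n ^ 2\<close> positions through the
  identity and, if \<open>d\<close> is odd, \<open>n\<close> more through the \<open>d\<close>-th
  power. The floor expression in the exponent encodes the parity \<open>d mod 2\<close>.\<close>

lemma card_invariants_matrix_flip: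
  fixes n a b :: nat
  defines "d \<equiv> n div gcd ((a + b) mod n) n"
  assumes a: "a < n" and b: "b < n"
  shows "real (card (invariants (binary_matrices n) (torus_matrix_action n) (a, b, True))) =
    2 powr (real n * (real n + real d - 2 * real_of_int \<lfloor>real d / 2\<rfloor>) / (2 * real d))"
proof -
  have n: "n > 0"
    using a by simp
  interpret group_action "torus_group n" "{0..<n} \<times> {0..<n}" "torus_action n"
    using n by (rule group_action_torus)
  let ?g = "(a, b, True)"
  let ?F = "\<lambda>k. card (invariants ({0..<n} \<times> {0..<n}) (torus_action n) (?g [^]\<^bsub>torus_group n\<^esub> k))"
  have d: "d > 0"
    using n by (simp add: d_def div_greater_zero_iff gcd_le2_nat)
  have d_dvd: "n dvd k * (a + b) \<longleftrightarrow> d dvd k" for k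
  proof -
    have "gcd ((a + b) mod n) n = gcd (a + b) n"
      by (metis gcd.commute gcd_red_nat)
    then show ?thesis
      unfolding d_def using dvd_mult_iff_div_gcd[OF n] by simp
  qed
  have even: "?F (2 * k) = (if k = 0 then n ^ 2 else 0)" if "k < d" for k
    using that n d_dvd[of k] nat_dvd_not_less[of k d]
    unfolding pow_flip_even by (auto simp: card_invariants_translation mod_eq_0_iff_dvd)
  have odd: "?F (2 * k + 1) = (if 2 * k + 1 = d then n else 0)" if "k < d" for k
  proof -
    \<comment> \<open>An odd power is a flip, so it has fixed positions iff \<open>n\<close> divides
      the sum of its two shifts.\<close>
    have "n dvd (k * (a + b) + a) mod n + (k * (a + b) + b) mod n \<longleftrightarrow>
        n dvd (2 * k + 1) * (a + b)"
    proof -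
      have "(k * (a + b) + a) + (k * (a + b) + b) = (2 * k + 1) * (a + b)"
        by (simp add: algebra_simps)
      then show ?thesis
        unfolding dvd_eq_mod_eq_0 mod_add_eq by (rule arg_cong)
    qed
    also have "\<dots> \<longleftrightarrow> 2 * k + 1 = d"
    proof -
      \<comment> \<open>As \<open>k < d\<close>, the number \<open>2 * k + 1\<close> is a positive
        multiple of \<open>d\<close> below \<open>2 * d\<close>.\<close>
      have "2 * k + 1 = d" if "d dvd 2 * k + 1"
      proof -
        obtain q where q: "2 * k + 1 = d * q" using \<open>d dvd 2 * k + 1\<close> by (rule dvdE)
        moreover have "2 * k + 1 < d * 2" using \<open>k < d\<close> by simp
        ultimately have "d * q < d * 2" by (simp only:)
        then have "q < 2" using d by (simp only: mult_less_cancel1)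
        then have "q = 0 \<or> q = 1" by auto
        then show ?thesis using q by auto
      qed
      then show ?thesis unfolding d_dvd by auto
    qed
    finally show ?thesis
      unfolding pow_flip_odd using n by (simp add: card_invariants_flip)
  qed
  have "(\<Sum>k<2 * d. ?F k) = (\<Sum>k<d. ?F (2 * k) + ?F (2 * k + 1))"
    by (rule sum_lessThan_double)
  also have "\<dots> = (\<Sum>k<d. if k = 0 then n ^ 2 else 0) + (\<Sum>k<d. if 2 * k + 1 = d then n else 0)"
    using even odd by (simp add: sum.distrib)
  also have "(\<Sum>k<d. if k = 0 then n ^ 2 else 0) = n ^ 2"
    using d by (simp add: sum.delta)
  also have "(\<Sum>k<d. if 2 * k + 1 = d then n else 0) = (d mod 2) * n"
  proof (cases "even d")
    case False
    then obtain m where m: "d = 2 * m + 1" by (rule oddE)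
    then show ?thesis by (simp add: sum.delta)
  qed auto
  finally have "(\<Sum>k<2 * d. ?F k) = n ^ 2 + (d mod 2) * n" .
  moreover have "?g [^]\<^bsub>torus_group n\<^esub> (2 * d) = \<one>\<^bsub>torus_group n\<^esub>"
    using d_dvd[of d] unfolding pow_flip_even by (simp add: one_torus_group)
  ultimately have "real (card (invariants (binary_matrices n) (torus_matrix_action n) ?g)) =
      2 powr ((real n ^ 2 + real (d mod 2) * real n) / (2 * real d))"
    using card_invariants_colouring[of ?g "2 * d" "{0, 1::nat}"] a b d
    by (simp add: carrier_torus_group binary_matrices_def)
  moreover have "real (d mod 2) = real d - 2 * real_of_int \<lfloor>real d / 2\<rfloor>"
  proof -
    have "\<lfloor>real d / 2\<rfloor> = int (d div 2)"
      using floor_divide_of_nat_eq[of d 2] by simp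
    moreover have "real d = 2 * real (d div 2) + real (d mod 2)"
      by (metis mult_div_mod_eq of_nat_add of_nat_mult of_nat_numeral)
    ultimately show ?thesis
      by linarith
  qed
  moreover have "real n ^ 2 + (real d - 2 * real_of_int \<lfloor>real d / 2\<rfloor>) * real n =
      real n * (real n + real d - 2 * real_of_int \<lfloor>real d / 2\<rfloor>)"
    by (simp add: algebra_simps power2_eq_square)
  ultimately show ?thesis
    by (simp only:)
qed

section \<open>Comparison with the generated permutation group, and the final count\<close>

text \<open>A homomorphic image of a generated group is generated by the images of the generators,
  which here are the two rotations and the transposition.\<close>

lemma image_torus_matrix_action:
  assumes n: "n > 0"
  shows "torus_matrix_action n ` carrier (torus_group n) = carrier (toroidal_group n)"
proof -
  interpret group_action "torus_group n" "{0..<n} \<times> {0..<n}" "torus_action n"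
    using n by (rule group_action_torus)
  interpret X: group_action "torus_group n" "binary_matrices n" "torus_matrix_action n"
    using group_action_colouring unfolding binary_matrices_def .
  interpret h: group_hom "torus_group n" "BijGroup (binary_matrices n)" "torus_matrix_action n"
    by (rule X.group_hom)
  \<comment> \<open>The inverse in the colouring action turns the shift by 1 into a shift by
    \<open>n - 1\<close>, as in \<open>row_rotation\<close>. For \<open>n = 1\<close> both shifts
    are 0.\<close>
  have row: "torus_matrix_action n (1 mod n, 0, False) = row_rotation n"
    using n
    by (cases "n = 1") (auto simp: colouring_action_def row_rotation_def inv_torus_group binary_matrices_def
        torus_action_def torus_map_def fun_eq_iff)
  have col: "torus_matrix_action n (0, 1 mod n, False) = column_rotation n"
    using n
    by (cases "n = 1") (auto simp: colouring_action_def column_rotation_def inv_torus_group binary_matrices_def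
        torus_action_def torus_map_def fun_eq_iff)
  have trans: "torus_matrix_action n (0, 0, True) = transposition n"
    using n
    by (auto simp: colouring_action_def transposition_def inv_torus_group binary_matrices_def
        torus_action_def torus_map_def fun_eq_iff)
  let ?S = "{(1 mod n, 0, False), (0, 1 mod n, False), (0, 0, True)}"
  have "carrier (toroidal_group n) =
      generate (BijGroup (binary_matrices n)) (torus_matrix_action n ` ?S)"
    using n by (simp only: carrier_toroidal_group Suc_le_eq One_nat_def image_insert image_empty
        flip: row col trans)
  also have "\<dots> = torus_matrix_action n ` generate (torus_group n) ?S"
    using n by (intro h.generate_img) (auto simp: carrier_torus_group)
  finally show ?thesis
    using generate_torus_group[OF n] by simp
qed

theorem theorem1:
  fixes n :: nat
  assumes "n \<ge> 1"
  shows "real (num_toroidal_arrays n) =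
    1 / 2 * a_diag n +
    1 / (2 * real n) *
      (\<Sum>d | d dvd n. real (totient d) *
         2 powr (real n * (real n + real d - 2 * real_of_int \<lfloor>real d / 2\<rfloor>) / (2 * real d)))"
proof -
  have n: "n > 0"
    using assms by simp
  interpret group_action "torus_group n" "{0..<n} \<times> {0..<n}" "torus_action n"
    using n by (rule group_action_torus)
  interpret X: group_action "torus_group n" "binary_matrices n" "torus_matrix_action n"
    using group_action_colouring unfolding binary_matrices_def .
  define I where "I = (\<lambda>g. real (card (invariants (binary_matrices n) (torus_matrix_action n) g)))"
  define f where "f = (\<lambda>d. 2 powr (real n * (real n + real d - 2 * real_of_int \<lfloor>real d / 2\<rfloor>) / (2 * real d)))"
  have carrier_eq: "carrier (torus_group n) = {..<n} \<times> {..<n} \<times> {False, True}"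
    by (auto simp: carrier_torus_group)
  \<comment> \<open>Orbits depend only on the set of permutations that occur, so the count may use
    \<open>torus_group\<close> even when several of its elements act alike.\<close>
  have "orbit (toroidal_group n) (\<lambda>g. g) = orbit (torus_group n) (torus_matrix_action n)"
    unfolding orbit_def image_torus_matrix_action[OF n, symmetric] by (auto simp: fun_eq_iff)
  then have "num_toroidal_arrays n = card (orbits (torus_group n) (binary_matrices n) (torus_matrix_action n))"
    by (simp add: num_toroidal_arrays_def orbits_def)
  then have "num_toroidal_arrays n * order (torus_group n) =
      (\<Sum>g\<in>carrier (torus_group n). card (invariants (binary_matrices n) (torus_matrix_action n) g))"
    using X.burnside finite_binary_matrices by (simp add: carrier_torus_group)
  then have "real (num_toroidal_arrays n) * real (order (torus_group n)) =
      (\<Sum>g\<in>carrier (torus_group n). I g)"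
    unfolding I_def by (simp flip: of_nat_mult of_nat_sum)
  moreover have "real (order (torus_group n)) = 2 * real n ^ 2"
    by (simp add: order_def carrier_torus_group power2_eq_square card_cartesian_product)
  moreover have "(\<Sum>g\<in>carrier (torus_group n). I g) =
      (\<Sum>a<n. \<Sum>b<n. I (a, b, False)) + (\<Sum>a<n. \<Sum>b<n. I (a, b, True))"
    unfolding carrier_eq by (simp add: sum.cartesian_product' sum.distrib)
  moreover have "(\<Sum>a<n. \<Sum>b<n. I (a, b, False)) = real n ^ 2 * a_diag n"
  proof -
    have "(\<Sum>a<n. \<Sum>b<n. I (a, b, False)) =
        (\<Sum>a<n. \<Sum>b<n. 2 powr (real n ^ 2 / real (lcm (n div gcd a n) (n div gcd b n))))"
      unfolding I_def by (intro sum.cong refl card_invariants_matrix_translation) auto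
    also have "\<dots> = (\<Sum>c | c dvd n. real (totient c) *
        (\<Sum>d | d dvd n. real (totient d) * 2 powr (real n ^ 2 / real (lcm c d))))"
      \<comment> \<open>The regrouping by order is applied once in each of the two residues.\<close>
      using n by (simp only: sum_div_gcd[where f = "\<lambda>d. 2 powr (real n ^ 2 / real (lcm (n div gcd _ n) d))"]
        sum_div_gcd[where f = "\<lambda>c. \<Sum>d | d dvd n. real (totient d) * 2 powr (real n ^ 2 / real (lcm c d))"])
    finally show ?thesis
      using n by (simp add: a_diag_def sum_distrib_left mult.assoc)
  qed
  moreover have "(\<Sum>a<n. \<Sum>b<n. I (a, b, True)) = real n * (\<Sum>d | d dvd n. real (totient d) * f d)"
  proof -
    have "(\<Sum>a<n. \<Sum>b<n. I (a, b, True)) = (\<Sum>a<n. \<Sum>b<n. f (n div gcd ((a + b) mod n) n))"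
      unfolding I_def f_def by (intro sum.cong refl card_invariants_matrix_flip) auto
    \<comment> \<open>For fixed \<open>a\<close> the sum \<open>a + b\<close> runs through all
      residues, so the inner sum no longer depends on \<open>a\<close> and the outer one becomes a
      factor \<open>n\<close>.\<close>
    also have "\<dots> = (\<Sum>a<n. \<Sum>s<n. f (n div gcd s n))"
      using sum_translate_mod[OF n, of "\<lambda>s. f (n div gcd s n)"] by simp
    finally show ?thesis
      using n by (simp add: sum_div_gcd)
  qed
  ultimately have "real n * (2 * real n * real (num_toroidal_arrays n)) =
      real n * (real n * a_diag n + (\<Sum>d | d dvd n. real (totient d) * f d))"
    by (simp add: algebra_simps power2_eq_square)
  then have "2 * real n * real (num_toroidal_arrays n) =
      real n * a_diag n + (\<Sum>d | d dvd n. real (totient d) * f d)"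
    using n by (simp only: mult_cancel_left) simp
  then have "real (num_toroidal_arrays n) =
      1 / 2 * a_diag n + 1 / (2 * real n) * (\<Sum>d | d dvd n. real (totient d) * f d)"
    using n by (simp add: field_simps)
  then show ?thesis
    by (simp only: f_def)
qed

end
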